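(* Let $k\ge 2$ be an integer, let $n$ and $s$ be positive multiples of $k$, and let $S=\{d_1,d_2,\dots,d_s\}$ be a set of integers with $1\le d_1<\dots<d_s<\frac n2$. If, for each $i\in\{1,2,\dots,k\}$, exactly $\frac sk$ of the $d_t$'s are congruent to $i$ modulo $k$, then the circulant graph $C_n(S)$ admits a neighborhood-balanced $k$-coloring.
   Context: A neighborhood-balanced $k$-coloring of a graph is a (not necessarily proper) vertex coloring with colors $1,\dots,k$ such that every vertex has the same number of neighbors of each of the $k$ colors. For integers $0<d_1<\dots<d_s<\frac n2$, the circulant graph $C_n(S)=C_n(d_1,\dots,d_s)$ is the $2s$-regular graph with vertex set $\mathbb{Z}_n$ in which the neighborhood of $j$ is $\{j\pm d_t: 1\le t\le s\}$, arithmetic being in $\mathbb{Z}_n$. *)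

theory Defs
  imports Complex_Main "HOL-Number_Theory.Cong" "Graph_Theory.Pair_Digraph"
begin

text \<open>
  As in \<open>Graph_Theory\<close>, an undirected graph is a symmetric digraph.  The vertices of the circulant
  graph are the canonical representatives \<open>0, \<dots>, n - 1\<close> of the residue classes modulo \<open>n\<close>.
\<close>

definition circulant_graph :: "nat \<Rightarrow> int set \<Rightarrow> int pair_pre_digraph" where
  "circulant_graph n S =
     \<lparr> pverts = {0..<int n},
       parcs = {(j, l). j \<in> {0..<int n} \<and>
                  (\<exists>d\<in>S. l = (j + d) mod int n \<or> l = (j - d) mod int n)} \<rparr>"

definition neighborhood :: "('a, 'b) pre_digraph \<Rightarrow> 'a \<Rightarrow> 'a set" where
  "neighborhood G v = {w \<in> verts G. v \<rightarrow>\<^bsub>G\<^esub> w}"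

text \<open>The coloring need not be proper, and not every color has to be used.\<close>

definition neighborhood_balanced_coloring ::
    "('a, 'b) pre_digraph \<Rightarrow> nat \<Rightarrow> ('a \<Rightarrow> nat) \<Rightarrow> bool" where
  "neighborhood_balanced_coloring G k c \<longleftrightarrow>
     (\<forall>v\<in>verts G. c v \<in> {1..k}) \<and>
     (\<forall>v\<in>verts G. \<forall>a\<in>{1..k}. \<forall>b\<in>{1..k}.
        card {w \<in> neighborhood G v. c w = a} = card {w \<in> neighborhood G v. c w = b})"

lemma neighborhood_circulant_graph:
  assumes "j \<in> {0..<int n}"
  shows "neighborhood (circulant_graph n S) j =
           (\<lambda>d. (j + d) mod int n) ` S \<union> (\<lambda>d. (j - d) mod int n) ` S"
  using assms unfolding neighborhood_def circulant_graph_def by auto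

lemma pair_graph_circulant_graph:
  assumes "\<And>d. d \<in> S \<Longrightarrow> 1 \<le> d \<and> 2 * d < int n"
  shows "pair_graph (circulant_graph n S)"
proof -
  let ?G = "circulant_graph n S"
  have wf: "l \<in> {0..<int n}" if "(j, l) \<in> parcs ?G" for j l
    using that by (auto simp: circulant_graph_def)
  have rev_arc: "(l, j) \<in> parcs ?G" if "(j, l) \<in> parcs ?G" for j l
  proof -
    from that obtain d where d: "d \<in> S" "j \<in> {0..<int n}"
        "l = (j + d) mod int n \<or> l = (j - d) mod int n"
      by (auto simp: circulant_graph_def)
    from d(2) have "(j + d - d) mod int n = j" "(j - d + d) mod int n = j" by simp_all
    then have "((j + d) mod int n - d) mod int n = j" "((j - d) mod int n + d) mod int n = j"
      unfolding mod_diff_left_eq mod_add_left_eq .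
    with d(3) have "j = (l - d) mod int n \<or> j = (l + d) mod int n" by metis
    with d(1) wf[OF that] show ?thesis unfolding circulant_graph_def by fastforce
  qed
  have loop: False if "(j, j) \<in> parcs ?G" for j
  proof -
    from that obtain d where d: "d \<in> S" "j \<in> {0..<int n}"
        "j = (j + d) mod int n \<or> j = (j - d) mod int n"
      by (auto simp: circulant_graph_def)
    from d(2) have eq: "j mod int n = j" by simp
    have "(j + d) mod int n = j mod int n \<or> (j - d) mod int n = j mod int n"
      unfolding eq using d(3) by argo
    then have "int n dvd d"
      by (auto simp: mod_eq_dvd_iff)
    with assms[OF d(1)] show False by (auto dest: zdvd_imp_le)
  qed
  have sub: "parcs ?G \<subseteq> {0..<int n} \<times> {0..<int n}"
  proof (rule subrelI)
    fix j l
    assume jl: "(j, l) \<in> parcs ?G"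
    then have "j \<in> {0..<int n}" by (simp add: circulant_graph_def)
    with wf[OF jl] show "(j, l) \<in> {0..<int n} \<times> {0..<int n}" by blast
  qed
  have verts: "pverts ?G = {0..<int n}" by (simp add: circulant_graph_def)
  show ?thesis
  proof
    show "finite (pverts ?G)" by (simp add: verts)
    show "finite (parcs ?G)" using sub by (rule finite_subset) simp
    show "symmetric (with_proj ?G)"
      unfolding symmetric_def with_proj_simps by (rule symI) (rule rev_arc)
  next
    fix e assume e: "e \<in> parcs ?G"
    show "fst e \<in> pverts ?G" "snd e \<in> pverts ?G"
      using subsetD[OF sub e] by (auto simp: verts)
    show "fst e \<noteq> snd e"
      using loop[of "fst e"] e by (cases e) auto
  qed
qed

lemma card_neighborhood_circulant_graph:
  assumes S: "\<And>d. d \<in> S \<Longrightarrow> 1 \<le> d \<and> 2 * d < int n" and j: "j \<in> {0..<int n}"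
  shows "card (neighborhood (circulant_graph n S) j) = 2 * card S"
proof -
  have fin: "finite S"
  proof (rule finite_subset)
    show "S \<subseteq> {0..int n}"
    proof
      fix d assume "d \<in> S"
      from S[OF this] show "d \<in> {0..int n}" by simp
    qed
  qed simp
  have inj: "inj_on (\<lambda>d. (j + d) mod int n) S" "inj_on (\<lambda>d. (j - d) mod int n) S"
  proof -
    have eq: "d = e" if "d \<in> S" "e \<in> S" "int n dvd d - e" for d e
    proof (rule ccontr)
      assume "d \<noteq> e"
      with that(3) have "int n \<le> \<bar>d - e\<bar>" using dvd_imp_le_int[of "d - e" "int n"] by simp
      with S[OF that(1)] S[OF that(2)] show False by linarith
    qed
    show "inj_on (\<lambda>d. (j + d) mod int n) S"
      by (rule inj_onI) (auto simp: mod_eq_dvd_iff intro: eq)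
    show "inj_on (\<lambda>d. (j - d) mod int n) S"
      by (rule inj_onI) (auto simp: mod_eq_dvd_iff intro: eq[symmetric])
  qed
  have "(j + d) mod int n \<noteq> (j - e) mod int n" if "d \<in> S" "e \<in> S" for d e
  proof
    assume "(j + d) mod int n = (j - e) mod int n"
    then have "int n dvd d + e" by (simp add: mod_eq_dvd_iff)
    with S[OF that(1)] S[OF that(2)] show False by (auto dest: zdvd_imp_le)
  qed
  then have "(\<lambda>d. (j + d) mod int n) ` S \<inter> (\<lambda>d. (j - d) mod int n) ` S = {}"
    by auto
  then show ?thesis
    using fin inj by (simp add: neighborhood_circulant_graph[OF j] card_Un_disjoint card_image)
qed

end

theory Submission
  imports Defs
begin

text \<open>
  Color \<open>j\<close> by its residue modulo \<open>k\<close>.  Since \<open>k dvd n\<close>, this color can be read off from any integer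
  representing \<open>j\<close> modulo \<open>n\<close>, so \<open>j + d\<close> and \<open>j - d\<close> receive a given color exactly if \<open>d\<close> lies in
  one prescribed class modulo \<open>k\<close> for each sign.  Every class modulo \<open>k\<close> contains \<open>s div k\<close> of the
  distances (\<open>card_residue_class\<close>), and different signed distances lead to different neighbors
  (\<open>inj_on_shift_mod\<close>).  Hence every vertex has exactly \<open>2 * (s div k)\<close> neighbors of each color.
\<close>

lemma card_residue_class:
  fixes S :: "int set"
  assumes "k > 0" and "\<forall>i\<in>{1..k}. card {d \<in> S. [d = int i] (mod int k)} = m"
  shows "card {d \<in> S. [d = r] (mod int k)} = m"
proof -
  \<comment> \<open>The representative of the class of \<open>r\<close> in \<open>{1..k}\<close>; the shift by 1 sends the zero class to \<open>k\<close>.\<close>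
  define i where "i = nat ((r - 1) mod int k) + 1"
  have i: "int i = (r - 1) mod int k + 1" and "(r - 1) mod int k < int k"
    using assms(1) by (simp_all add: i_def)
  then have "int i \<le> int k" by linarith
  moreover have "1 \<le> i" by (simp add: i_def)
  ultimately have "i \<in> {1..k}" by simp
  then have "card {d \<in> S. [d = int i] (mod int k)} = m" using assms(2) by blast
  moreover have "[int i = r] (mod int k)"
    unfolding i cong_def by (simp add: mod_add_left_eq)
  then have "[d = int i] (mod int k) \<longleftrightarrow> [d = r] (mod int k)" for d
    by (meson cong_sym cong_trans)
  ultimately show ?thesis by simp
qed

text \<open>
  Two of these integers differ by less than \<open>n\<close>.  Admitting negative \<open>d\<close> gives at once that the
  neighbors \<open>j + d\<close> are distinct, that the neighbors \<open>j - d\<close> are, and that no neighbor is of both kinds.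
\<close>

lemma inj_on_shift_mod:
  fixes j :: int
  shows "inj_on (\<lambda>d. (j + d) mod int n) {d. 2 * \<bar>d\<bar> < int n}"
proof (rule inj_onI)
  fix d e assume de: "d \<in> {d. 2 * \<bar>d\<bar> < int n}" "e \<in> {d. 2 * \<bar>d\<bar> < int n}"
    and "(j + d) mod int n = (j + e) mod int n"
  then have dvd: "int n dvd d - e" by (simp add: mod_eq_dvd_iff)
  show "d = e"
  proof (rule ccontr)
    assume "d \<noteq> e"
    with dvd have "int n \<le> \<bar>d - e\<bar>" using dvd_imp_le_int[of "d - e" "int n"] by simp
    with de show False by auto
  qed
qed

lemma card_neighbors_filter:
  assumes S: "\<And>d. d \<in> S \<Longrightarrow> 1 \<le> d \<and> 2 * d < int n" and "finite S" and j: "j \<in> {0..<int n}"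
  shows "card {w \<in> neighborhood (circulant_graph n S) j. P w} =
           card {d \<in> S. P ((j + d) mod int n)} + card {d \<in> S. P ((j - d) mod int n)}"
proof -
  let ?f = "\<lambda>d. (j + d) mod int n"
  let ?A = "{d \<in> S. P ((j + d) mod int n)}" and ?B = "{d \<in> S. P ((j - d) mod int n)}"
  have "{w \<in> neighborhood (circulant_graph n S) j. P w} = ?f ` (?A \<union> uminus ` ?B)"
    unfolding neighborhood_circulant_graph[OF j] image_Un image_image by auto
  moreover have "inj_on ?f (?A \<union> uminus ` ?B)"
    by (rule inj_on_subset[OF inj_on_shift_mod]) (use S in force)
  moreover have "?A \<inter> uminus ` ?B = {}" by (fastforce dest: S)
  then have "card (?A \<union> uminus ` ?B) = card ?A + card (uminus ` ?B)"
    using assms(2) by (intro card_Un_disjoint) auto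
  ultimately show ?thesis by (simp add: card_image)
qed

theorem theorem4p6:
  fixes k n s :: nat and S :: "int set"
  assumes "k \<ge> 2"
    and "n > 0" and "k dvd n"
    and "s > 0" and "k dvd s"
    and "card S = s"
    and "\<forall>d\<in>S. 1 \<le> d \<and> real_of_int d < real n / 2"
    and "\<forall>i\<in>{1..k}. card {d \<in> S. [d = int i] (mod int k)} = s div k"
  shows "\<exists>c. neighborhood_balanced_coloring (with_proj (circulant_graph n S)) k c"
proof -
  define c where "c v = nat (v mod int k) + 1" for v :: int
  have c_mod: "c (x mod int n) = a \<longleftrightarrow> [x = int a - 1] (mod int k)" if "a \<in> {1..k}" for x a
  proof -
    have "x mod int n mod int k = x mod int k" using assms(3) by (simp add: mod_mod_cancel)
    moreover have "(int a - 1) mod int k = int a - 1" using that by simp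
    moreover have "nat (x mod int k) + 1 = a \<longleftrightarrow> x mod int k = int a - 1"
      using assms(1) pos_mod_sign[of "int k" x] by linarith
    ultimately show ?thesis by (simp add: c_def cong_def)
  qed
  have S: "1 \<le> d \<and> 2 * d < int n" if "d \<in> S" for d
    using bspec[OF assms(7) that] by linarith
  have "finite S" using assms(4,6) card_gt_0_iff by blast
  have count: "card {w \<in> neighborhood (circulant_graph n S) v. c w = a} = 2 * (s div k)"
    if v: "v \<in> {0..<int n}" and a: "a \<in> {1..k}" for v a
  proof -
    have plus: "[v + d = int a - 1] (mod int k) \<longleftrightarrow> [d = int a - 1 - v] (mod int k)" for d
      by (simp add: cong_iff_dvd_diff algebra_simps)
    have "v - d - (int a - 1) = - (d - (v - (int a - 1)))" for d by simp
    then have minus: "[v - d = int a - 1] (mod int k) \<longleftrightarrow> [d = v - (int a - 1)] (mod int k)" for d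
      unfolding cong_iff_dvd_diff by (metis dvd_minus_iff)
    have "k > 0" using assms(1) by simp
    note card_residue_class[OF this assms(8)]
    then show ?thesis
      by (simp only: card_neighbors_filter[OF S \<open>finite S\<close> v] c_mod[OF a] plus minus)
  qed
  have "c v \<in> {1..k}" for v
    using assms(1) pos_mod_bound[of "int k" v] unfolding c_def atLeastAtMost_iff by linarith
  moreover have "verts (circulant_graph n S) = {0..<int n}"
    by (simp add: circulant_graph_def)
  ultimately have "neighborhood_balanced_coloring (circulant_graph n S) k c"
    unfolding neighborhood_balanced_coloring_def by (metis count)
  then show ?thesis by blast
qed

end
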